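(* The free (non-unital) Jacobi-Jordan algebra $JJ(X,Y)$ over $\mathbb{K}$ with two generators $X,Y$ is finite dimensional and $$JJ(X,Y)=\mathbb{K}\{X,Y\}\oplus\mathbb{K}\{X^2,Y^2,XY\}\oplus\mathbb{K}\{X^2Y,XY^2\}\oplus\mathbb{K}\{X^2Y^2\}.$$
   Context: $\mathbb{K}$ is a field of characteristic $0$. A Jacobi-Jordan algebra is a $\mathbb{K}$-vector space $A$ with a commutative bilinear product satisfying $x(yz)+y(zx)+z(xy)=0$ for all $x,y,z\in A$. $\mathbb{K}\{u_1,\dots,u_r\}$ denotes the $\mathbb{K}$-vector space with basis $u_1,\dots,u_r$. Here $X^2=XX$, $X^2Y=(X^2)Y$, $XY^2=X(Y^2)$, $X^2Y^2=(X^2)(Y^2)$, and the four summands are the homogeneous components of degrees $1,2,3,4$ for the grading in which $X$ and $Y$ have degree $1$. *)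

theory Defs
  imports Complex_Main "HOL-Library.Poly_Mapping"
begin

locale jacobi_jordan_algebra = vector_space scale
  for scale :: "'k::field \<Rightarrow> 'a::ab_group_add \<Rightarrow> 'a" +
  fixes mult :: "'a \<Rightarrow> 'a \<Rightarrow> 'a"
  assumes mult_commute: "mult x y = mult y x"
    and mult_add_left: "mult (x + y) z = mult x z + mult y z"
    and mult_scale_left: "mult (scale c x) y = scale c (mult x y)"
    and jacobi: "mult x (mult y z) + mult y (mult z x) + mult z (mult x y) = 0"
begin

lemma mult_add_right: "mult z (x + y) = mult z x + mult z y"
  using mult_add_left mult_commute by metis

lemma mult_scale_right: "mult y (scale c x) = scale c (mult y x)"
  using mult_scale_left mult_commute by metis

lemma mult_zero_left: "mult 0 x = 0"
  using mult_add_left[of 0 0 x] by simp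

lemma mult_zero_right: "mult x 0 = 0"
  using mult_zero_left mult_commute by metis

definition is_basis :: "'a list \<Rightarrow> 'a set \<Rightarrow> bool" where
  "is_basis us V \<longleftrightarrow> distinct us \<and> independent (set us) \<and> span (set us) = V"

end

definition internal_direct_sum :: "'i set \<Rightarrow> ('i \<Rightarrow> 'a::comm_monoid_add set) \<Rightarrow> 'a set \<Rightarrow> bool" where
  "internal_direct_sum I V W \<longleftrightarrow>
     W = {\<Sum>i\<in>I. c i |c. \<forall>i\<in>I. c i \<in> V i} \<and>
     (\<forall>c. (\<forall>i\<in>I. c i \<in> V i) \<and> (\<Sum>i\<in>I. c i) = 0 \<longrightarrow> (\<forall>i\<in>I. c i = 0))"

text \<open>Non-associative monomials in the generators; there is no empty monomial, so the
  algebra below is non-unital. Its elements are the finitely supported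
  linear combinations of such monomials.\<close>

datatype 'g magma = Gen 'g | MProd "'g magma" "'g magma"

primrec mdeg :: "'g magma \<Rightarrow> nat" where
  "mdeg (Gen g) = 1"
| "mdeg (MProd u v) = mdeg u + mdeg v"

type_synonym ('g, 'k) free_alg = "'g magma \<Rightarrow>\<^sub>0 'k"

lift_definition fa_scale :: "'k::field \<Rightarrow> ('g, 'k) free_alg \<Rightarrow> ('g, 'k) free_alg"
  is "\<lambda>c f m. c * f m"
  by (rule finite_subset) auto

text \<open>Every monomial of degree at least two factors uniquely, so the bilinear extension of
  \<^const>\<open>MProd\<close> has a single product of coefficients as its coefficient at
  \<^term>\<open>MProd u v\<close>.\<close>

lift_definition fa_mult ::
  "('g, 'k::field) free_alg \<Rightarrow> ('g, 'k) free_alg \<Rightarrow> ('g, 'k) free_alg"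
  is "\<lambda>f g m. case m of Gen _ \<Rightarrow> 0 | MProd u v \<Rightarrow> f u * g v"
proof -
  fix f g :: "'g magma \<Rightarrow> 'k"
  assume fin: "finite {x. f x \<noteq> 0}" "finite {x. g x \<noteq> 0}"
  have "{m. (case m of Gen _ \<Rightarrow> 0 | MProd u v \<Rightarrow> f u * g v) \<noteq> 0} \<subseteq>
        case_prod MProd ` ({x. f x \<noteq> 0} \<times> {x. g x \<noteq> 0})"
    (is "?L \<subseteq> ?R")
  proof
    fix m assume "m \<in> ?L"
    then show "m \<in> ?R" by (cases m) force+
  qed
  then show "finite {m. (case m of Gen _ \<Rightarrow> 0 | MProd u v \<Rightarrow> f u * g v) \<noteq> 0}"
    by (rule finite_subset) (intro finite_imageI finite_cartesian_product fin)
qed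

lemma lookup_fa_scale [simp]: "Poly_Mapping.lookup (fa_scale c f) m = c * Poly_Mapping.lookup f m"
  by transfer simp

lemma lookup_fa_mult [simp]:
  "Poly_Mapping.lookup (fa_mult f g) (Gen x) = 0"
  "Poly_Mapping.lookup (fa_mult f g) (MProd u v) = Poly_Mapping.lookup f u * Poly_Mapping.lookup g v"
  by (transfer; simp)+

lemma fa_eqI:
  fixes f g :: "('g, 'k::field) free_alg"
  assumes "\<And>x. Poly_Mapping.lookup f (Gen x) = Poly_Mapping.lookup g (Gen x)"
    and "\<And>u v. Poly_Mapping.lookup f (MProd u v) = Poly_Mapping.lookup g (MProd u v)"
  shows "f = g"
  using assms by (metis magma.exhaust poly_mapping_eqI)

lemma vector_space_fa: "vector_space (fa_scale :: 'k::field \<Rightarrow> _ \<Rightarrow> ('g, 'k) free_alg)"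
  by unfold_locales (auto intro!: poly_mapping_eqI simp: lookup_add algebra_simps)

lemma fa_mult_simps:
  "fa_mult (f + g) h = fa_mult f h + fa_mult g h"
  "fa_mult h (f + g) = fa_mult h f + fa_mult h g"
  "fa_mult (f - g) h = fa_mult f h - fa_mult g h"
  "fa_mult h (f - g) = fa_mult h f - fa_mult h g"
  "fa_mult (fa_scale c f) h = fa_scale c (fa_mult f h)"
  "fa_mult h (fa_scale c f) = fa_scale c (fa_mult h f)"
  by (rule fa_eqI; simp add: lookup_add lookup_minus algebra_simps)+

lemma fa_mult_single:
  "fa_mult (Poly_Mapping.single u a) (Poly_Mapping.single v b) = Poly_Mapping.single (MProd u v) (a * b)"
  by (rule fa_eqI) (auto simp: lookup_single when_def)

lemma fa_induct [case_names single add]: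
  fixes f :: "('g, 'k::field) free_alg"
  assumes "\<And>u c. P (Poly_Mapping.single u c)" and "\<And>f g. P f \<Longrightarrow> P g \<Longrightarrow> P (f + g)"
  shows "P f"
proof (induction f rule: update_induct)
  case const
  show ?case using assms(1)[of _ 0] by simp
next
  case (update f a b)
  have "Poly_Mapping.update a b f = f + Poly_Mapping.single a b"
    using update.hyps
    by (intro poly_mapping_eqI)
      (auto simp: lookup_update lookup_add lookup_single when_def in_keys_iff)
  then show ?case using assms update by metis
qed

inductive_set jj_ideal :: "('g, 'k::field) free_alg set" where
  comm: "fa_mult x y - fa_mult y x \<in> jj_ideal"
| jacobi: "fa_mult x (fa_mult y z) + fa_mult y (fa_mult z x) + fa_mult z (fa_mult x y) \<in> jj_ideal"
| add: "x \<in> jj_ideal \<Longrightarrow> y \<in> jj_ideal \<Longrightarrow> x + y \<in> jj_ideal"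
| scale: "x \<in> jj_ideal \<Longrightarrow> fa_scale c x \<in> jj_ideal"
| mult_left: "x \<in> jj_ideal \<Longrightarrow> fa_mult a x \<in> jj_ideal"
| mult_right: "x \<in> jj_ideal \<Longrightarrow> fa_mult x a \<in> jj_ideal"

lemma jj_ideal_zero: "0 \<in> jj_ideal"
  using jj_ideal.comm[of 0 0] by simp

lemma jj_ideal_uminus: "x \<in> jj_ideal \<Longrightarrow> - x \<in> jj_ideal"
proof -
  have "- x = fa_scale (- 1) x" by (rule poly_mapping_eqI) simp
  then show "x \<in> jj_ideal \<Longrightarrow> - x \<in> jj_ideal" by (simp add: jj_ideal.scale)
qed

lemma jj_ideal_diff: "x \<in> jj_ideal \<Longrightarrow> y \<in> jj_ideal \<Longrightarrow> x - y \<in> jj_ideal"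
  using jj_ideal.add[OF _ jj_ideal_uminus, of x y] by simp

definition jj_rel :: "('g, 'k::field) free_alg \<Rightarrow> ('g, 'k) free_alg \<Rightarrow> bool" where
  "jj_rel f g \<longleftrightarrow> f - g \<in> jj_ideal"

lemma equivp_jj_rel: "equivp (jj_rel :: ('g, 'k::field) free_alg \<Rightarrow> _)"
proof (rule equivpI)
  show "reflp (jj_rel :: ('g, 'k) free_alg \<Rightarrow> _)" by (auto simp: reflp_def jj_rel_def jj_ideal_zero)
  show "symp (jj_rel :: ('g, 'k) free_alg \<Rightarrow> _)" by (auto simp: symp_def jj_rel_def dest: jj_ideal_uminus)
  show "transp (jj_rel :: ('g, 'k) free_alg \<Rightarrow> _)"
  proof (rule transpI)
    fix f g h :: "('g, 'k) free_alg"
    assume "jj_rel f g" "jj_rel g h"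
    then have "(f - g) + (g - h) \<in> jj_ideal"
      unfolding jj_rel_def by (rule jj_ideal.add)
    then show "jj_rel f h" by (simp add: jj_rel_def)
  qed
qed

lemma jj_rel_eqI: "f = g \<Longrightarrow> jj_rel f g"
  by (simp add: jj_rel_def jj_ideal_zero)

quotient_type (overloaded) ('g, 'k) free_jj = "('g, 'k::field) free_alg" / jj_rel
  by (rule equivp_jj_rel)

instantiation free_jj :: (type, field) "{ab_group_add, times}"
begin

lift_definition zero_free_jj :: "('a, 'b) free_jj" is 0 .

lift_definition plus_free_jj :: "('a, 'b) free_jj \<Rightarrow> ('a, 'b) free_jj \<Rightarrow> ('a, 'b) free_jj" is "(+)"
proof -
  fix f f' g g' :: "('a, 'b) free_alg"
  assume "jj_rel f f'" "jj_rel g g'"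
  then have "(f - f') + (g - g') \<in> jj_ideal"
    unfolding jj_rel_def by (rule jj_ideal.add)
  then show "jj_rel (f + g) (f' + g')"
    by (simp add: jj_rel_def algebra_simps)
qed

lift_definition uminus_free_jj :: "('a, 'b) free_jj \<Rightarrow> ('a, 'b) free_jj" is uminus
proof -
  fix f f' :: "('a, 'b) free_alg"
  assume "jj_rel f f'"
  then have "- (f - f') \<in> jj_ideal"
    unfolding jj_rel_def by (rule jj_ideal_uminus)
  then show "jj_rel (- f) (- f')" by (simp add: jj_rel_def)
qed

lift_definition minus_free_jj :: "('a, 'b) free_jj \<Rightarrow> ('a, 'b) free_jj \<Rightarrow> ('a, 'b) free_jj" is "(-)"
proof -
  fix f f' g g' :: "('a, 'b) free_alg"
  assume "jj_rel f f'" "jj_rel g g'"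
  then have "(f - f') - (g - g') \<in> jj_ideal"
    unfolding jj_rel_def by (rule jj_ideal_diff)
  then show "jj_rel (f - g) (f' - g')"
    by (simp add: jj_rel_def algebra_simps)
qed

lift_definition times_free_jj :: "('a, 'b) free_jj \<Rightarrow> ('a, 'b) free_jj \<Rightarrow> ('a, 'b) free_jj" is fa_mult
proof -
  fix f f' g g' :: "('a, 'b) free_alg"
  assume "jj_rel f f'" "jj_rel g g'"
  then have "fa_mult (f - f') g + fa_mult f' (g - g') \<in> jj_ideal"
    unfolding jj_rel_def by (blast intro: jj_ideal.add jj_ideal.mult_left jj_ideal.mult_right)
  then show "jj_rel (fa_mult f g) (fa_mult f' g')"
    by (simp add: jj_rel_def fa_mult_simps)
qed

instance
proof
  fix a b c :: "('a, 'b) free_jj"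
  show "a + b + c = a + (b + c)" by transfer (simp add: jj_rel_eqI add.assoc)
  show "a + b = b + a" by transfer (simp add: jj_rel_eqI add.commute)
  show "0 + a = a" by transfer (simp add: jj_rel_eqI)
  show "- a + a = 0" by transfer (simp add: jj_rel_eqI)
  show "a - b = a + - b" by transfer (simp add: jj_rel_eqI)
qed

end

lift_definition jj_scale :: "'k::field \<Rightarrow> ('g, 'k) free_jj \<Rightarrow> ('g, 'k) free_jj" is fa_scale
proof -
  fix c :: 'k and f g :: "('g, 'k) free_alg"
  have "fa_scale c f - fa_scale c g = fa_scale c (f - g)"
    by (rule poly_mapping_eqI) (simp add: lookup_minus algebra_simps)
  then show "jj_rel f g \<Longrightarrow> jj_rel (fa_scale c f) (fa_scale c g)"
    by (simp add: jj_rel_def jj_ideal.scale)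
qed

lift_definition jj_gen :: "'g \<Rightarrow> ('g, 'k::field) free_jj"
  is "\<lambda>g. Poly_Mapping.single (Gen g) 1" .

global_interpretation free_jj:
  jacobi_jordan_algebra "jj_scale :: 'k::field \<Rightarrow> ('g, 'k) free_jj \<Rightarrow> ('g, 'k) free_jj" "(*)"
proof -
  interpret fa: vector_space "fa_scale :: 'k \<Rightarrow> _ \<Rightarrow> ('g, 'k) free_alg"
    by (rule vector_space_fa)
  show "jacobi_jordan_algebra (jj_scale :: 'k \<Rightarrow> ('g, 'k) free_jj \<Rightarrow> ('g, 'k) free_jj) (*)"
  proof
    fix x y z :: "('g, 'k) free_jj" and a b :: 'k
    show "jj_scale a (x + y) = jj_scale a x + jj_scale a y"
      by transfer (simp add: jj_rel_eqI fa.scale_right_distrib)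
    show "jj_scale (a + b) x = jj_scale a x + jj_scale b x"
      by transfer (simp add: jj_rel_eqI fa.scale_left_distrib)
    show "jj_scale a (jj_scale b x) = jj_scale (a * b) x"
      by transfer (simp add: jj_rel_eqI)
    show "jj_scale 1 x = x"
      by transfer (simp add: jj_rel_eqI)
    show "x * y = y * x"
      by transfer (simp add: jj_rel_def jj_ideal.comm)
    show "(x + y) * z = x * z + y * z"
      by transfer (simp add: jj_rel_eqI fa_mult_simps)
    show "jj_scale a x * y = jj_scale a (x * y)"
      by transfer (simp add: jj_rel_eqI fa_mult_simps)
    show "x * (y * z) + y * (z * x) + z * (x * y) = 0"
      by transfer (simp add: jj_rel_def jj_ideal.jacobi)
  qed
qed

lemma free_jj_induct [case_names gen add scale mult]:
  fixes x :: "('g, 'k::field) free_jj"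
  assumes gen: "\<And>g. P (jj_gen g)"
    and add: "\<And>x y. P x \<Longrightarrow> P y \<Longrightarrow> P (x + y)"
    and scale: "\<And>c x. P x \<Longrightarrow> P (jj_scale c x)"
    and mult: "\<And>x y. P x \<Longrightarrow> P y \<Longrightarrow> P (x * y)"
  shows "P x"
proof -
  have mono: "P (abs_free_jj (Poly_Mapping.single u 1))" for u
  proof (induction u)
    case (Gen g)
    show ?case using gen[of g] by (simp add: jj_gen.abs_eq)
  next
    case (MProd u v)
    then have "P (abs_free_jj (Poly_Mapping.single u 1) * abs_free_jj (Poly_Mapping.single v 1))"
      by (rule mult)
    then show ?case by (simp add: times_free_jj.abs_eq fa_mult_single)
  qed
  have "P (abs_free_jj f)" for f
  proof (induction f rule: fa_induct)
    case (single u c)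
    have "Poly_Mapping.single u c = fa_scale c (Poly_Mapping.single u 1)"
      by (rule poly_mapping_eqI) (simp add: lookup_single when_def)
    then show ?case using scale[OF mono, of c u] by (simp add: jj_scale.abs_eq)
  next
    case (add f g)
    then show ?case using assms(2) by (metis plus_free_jj.abs_eq)
  qed
  then show ?thesis by (metis Quotient_free_jj Quotient_abs_rep)
qed

theorem free_jj_universal:
  fixes s :: "'k::field \<Rightarrow> 'b::ab_group_add \<Rightarrow> 'b" and m :: "'b \<Rightarrow> 'b \<Rightarrow> 'b" and \<phi> :: "'g \<Rightarrow> 'b"
  assumes "jacobi_jordan_algebra s m"
  shows "\<exists>!h. Vector_Spaces.linear jj_scale s h \<and>
              (\<forall>x y. h (x * y) = m (h x) (h y)) \<and> (\<forall>g. h (jj_gen g) = \<phi> g)"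
proof -
  interpret B: jacobi_jordan_algebra s m by fact
  define ev :: "'g magma \<Rightarrow> 'b" where "ev = rec_magma \<phi> (\<lambda>_ _. m)"
  have ev [simp]: "ev (Gen g) = \<phi> g" "ev (MProd u v) = m (ev u) (ev v)" for g u v
    by (simp_all add: ev_def)
  define H :: "('g, 'k) free_alg \<Rightarrow> 'b"
    where "H f = (\<Sum>u\<in>Poly_Mapping.keys f. s (Poly_Mapping.lookup f u) (ev u))" for f
  have H_sup: "H f = (\<Sum>u\<in>S. s (Poly_Mapping.lookup f u) (ev u))"
    if "finite S" "Poly_Mapping.keys f \<subseteq> S" for f S
    unfolding H_def using that
    by (intro sum.mono_neutral_left) (auto simp: in_keys_iff)
  have H_add: "H (f + g) = H f + H g" for f g
  proof -
    let ?S = "Poly_Mapping.keys f \<union> Poly_Mapping.keys g"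
    have "H (f + g) = (\<Sum>u\<in>?S. s (Poly_Mapping.lookup (f + g) u) (ev u))"
      using keys_add[of f g] by (intro H_sup) auto
    also have "\<dots> = (\<Sum>u\<in>?S. s (Poly_Mapping.lookup f u) (ev u)) + (\<Sum>u\<in>?S. s (Poly_Mapping.lookup g u) (ev u))"
      by (simp add: lookup_add B.scale_left_distrib sum.distrib)
    also have "\<dots> = H f + H g" by (simp add: H_sup[of ?S f] H_sup[of ?S g])
    finally show ?thesis .
  qed
  have H_scale: "H (fa_scale c f) = s c (H f)" for c f
  proof -
    have "H (fa_scale c f) = (\<Sum>u\<in>Poly_Mapping.keys f. s (Poly_Mapping.lookup (fa_scale c f) u) (ev u))"
      by (rule H_sup) (auto simp: in_keys_iff)
    then show ?thesis by (simp add: H_def B.scale_sum_right)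
  qed
  have H_single: "H (Poly_Mapping.single u c) = s c (ev u)" for u c
    by (simp add: H_def)
  have H_diff: "H (f - g) = H f - H g" for f g
    using H_add[of "f - g" g] by (simp add: algebra_simps)
  have H_mult: "H (fa_mult f g) = m (H f) (H g)" for f g
  proof (induction f rule: fa_induct)
    case (single u c)
    show ?case
      by (induction g rule: fa_induct)
        (simp_all add: fa_mult_single H_single fa_mult_simps H_add B.mult_add_right
          B.mult_scale_left B.mult_scale_right)
  qed (simp add: fa_mult_simps H_add B.mult_add_left)
  have H_ideal: "H f = 0" if "f \<in> jj_ideal" for f
    using that
  proof induction
    case (comm x y)
    show ?case by (simp add: H_diff H_mult B.mult_commute)
  next
    case (jacobi x y z)
    show ?case by (simp add: H_add H_mult B.jacobi)
  qed (simp_all add: H_add H_scale H_mult B.mult_zero_left B.mult_zero_right)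
  have H_rel: "H f = H g" if "jj_rel f g" for f g
    using H_ideal[of "f - g"] that by (simp add: jj_rel_def H_diff)
  define h where "h x = H (rep_free_jj x)" for x
  have h_abs: "h (abs_free_jj f) = H f" for f
    unfolding h_def by (rule H_rel) (metis Quotient_free_jj Quotient_rep_abs equivp_jj_rel equivp_reflp)
  have abs_ex: "\<exists>f. x = abs_free_jj f" for x :: "('g, 'k) free_jj"
    by (metis Quotient_free_jj Quotient_abs_rep)
  show ?thesis
  proof (rule ex1I[of _ h])
    have "h (x + y) = h x + h y" for x y
      using abs_ex[of x] abs_ex[of y] by (auto simp: plus_free_jj.abs_eq h_abs H_add)
    moreover have "h (jj_scale c x) = s c (h x)" for c x
      using abs_ex[of x] by (auto simp: jj_scale.abs_eq h_abs H_scale)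
    ultimately have "Vector_Spaces.linear jj_scale s h"
      by unfold_locales auto
    moreover have "h (x * y) = m (h x) (h y)" for x y
      using abs_ex[of x] abs_ex[of y] by (auto simp: times_free_jj.abs_eq h_abs H_mult)
    moreover have "h (jj_gen g) = \<phi> g" for g
      by (simp add: jj_gen.abs_eq h_abs H_single)
    ultimately show "Vector_Spaces.linear jj_scale s h \<and>
        (\<forall>x y. h (x * y) = m (h x) (h y)) \<and> (\<forall>g. h (jj_gen g) = \<phi> g)" by blast
  next
    fix h'
    assume h': "Vector_Spaces.linear jj_scale s h' \<and>
        (\<forall>x y. h' (x * y) = m (h' x) (h' y)) \<and> (\<forall>g. h' (jj_gen g) = \<phi> g)"
    then interpret h': Vector_Spaces.linear jj_scale s h' by simp
    have h_simps: "h (jj_gen g) = \<phi> g" "h (x + y) = h x + h y" "h (jj_scale c x) = s c (h x)"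
      "h (x * y) = m (h x) (h y)" for g x y c
      using abs_ex[of x] abs_ex[of y]
      by (auto simp: jj_gen.abs_eq plus_free_jj.abs_eq jj_scale.abs_eq times_free_jj.abs_eq
          h_abs H_single H_add H_scale H_mult)
    show "h' = h"
    proof
      fix x show "h' x = h x"
        by (induction x rule: free_jj_induct)
          (use h' in \<open>simp_all add: h_simps h'.add h'.scale\<close>)
    qed
  qed
qed

definition jj_component :: "nat \<Rightarrow> ('g, 'k::field) free_jj set" where
  "jj_component n = abs_free_jj ` {f. \<forall>u\<in>Poly_Mapping.keys f. mdeg u = n}"

lemma jj_component_mult:
  assumes "x \<in> jj_component m" "y \<in> jj_component n"
  shows "x * y \<in> jj_component (m + n)"
proof -
  obtain f g where fg: "x = abs_free_jj f" "y = abs_free_jj g"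
    "\<forall>u\<in>Poly_Mapping.keys f. mdeg u = m" "\<forall>u\<in>Poly_Mapping.keys g. mdeg u = n"
    using assms by (auto simp: jj_component_def)
  have "mdeg w = m + n" if "w \<in> Poly_Mapping.keys (fa_mult f g)" for w
    using that fg by (cases w) (auto simp: in_keys_iff)
  then show ?thesis
    using fg by (auto simp: jj_component_def times_free_jj.abs_eq)
qed

lift_definition fa_part :: "nat \<Rightarrow> ('g, 'k::field) free_alg \<Rightarrow> ('g, 'k) free_alg"
  is "\<lambda>n f m. if mdeg m = n then f m else 0"
  by (rule finite_subset) auto

lemma lookup_fa_part [simp]:
  "Poly_Mapping.lookup (fa_part n f) m = (if mdeg m = n then Poly_Mapping.lookup f m else 0)"
  by transfer simp

lemma fa_part_add: "fa_part n (f + g) = fa_part n f + fa_part n g"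
  by (rule poly_mapping_eqI) (simp add: lookup_add)

lemma fa_part_scale: "fa_part n (fa_scale c f) = fa_scale c (fa_part n f)"
  by (rule poly_mapping_eqI) simp

lemma fa_part_cases:
  assumes "\<forall>u\<in>Poly_Mapping.keys f. mdeg u = d"
  shows "fa_part n f = (if n = d then f else 0)"
  using assms by (intro poly_mapping_eqI) (auto simp: in_keys_iff)

lemma fa_part_single:
  "fa_part n (Poly_Mapping.single u c) = (if n = mdeg u then Poly_Mapping.single u c else 0)"
  by (intro poly_mapping_eqI) (auto simp: lookup_single when_def)

lemma fa_part_mult_single_left:
  "fa_part n (fa_mult (Poly_Mapping.single u c) f) =
     (if mdeg u \<le> n then fa_mult (Poly_Mapping.single u c) (fa_part (n - mdeg u) f) else 0)"
  by (rule fa_eqI) (auto simp: lookup_single when_def)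

lemma fa_part_mult_single_right:
  "fa_part n (fa_mult f (Poly_Mapping.single u c)) =
     (if mdeg u \<le> n then fa_mult (fa_part (n - mdeg u) f) (Poly_Mapping.single u c) else 0)"
  by (rule fa_eqI) (auto simp: lookup_single when_def)

lemma fa_part_jj_ideal:
  fixes f :: "('g, 'k::field) free_alg"
  assumes "f \<in> jj_ideal"
  shows "fa_part n f \<in> jj_ideal"
  using assms
proof (induction arbitrary: n)
  case (comm x y)
  let ?C = "\<lambda>x y. fa_mult x y - fa_mult y x"
  show ?case
  proof (induction x rule: fa_induct)
    case (single u a)
    show ?case
    proof (induction y rule: fa_induct)
      case (single v b)
      let ?c = "?C (Poly_Mapping.single u a) (Poly_Mapping.single v b)"
      have "\<forall>w\<in>Poly_Mapping.keys ?c. mdeg w = mdeg u + mdeg v"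
        by (auto simp: fa_mult_single in_keys_iff lookup_minus lookup_single when_def split: if_splits)
      from fa_part_cases[OF this] show ?case by (simp add: jj_ideal.comm jj_ideal_zero)
    next
      case (add f g)
      have "?C (Poly_Mapping.single u a) (f + g) =
            ?C (Poly_Mapping.single u a) f + ?C (Poly_Mapping.single u a) g"
        by (simp add: fa_mult_simps)
      then show ?case using add jj_ideal.add by (metis fa_part_add)
    qed
  next
    case (add f g)
    have "?C (f + g) y = ?C f y + ?C g y" by (simp add: fa_mult_simps)
    then show ?case using add jj_ideal.add by (metis fa_part_add)
  qed
next
  case (jacobi x y z)
  let ?J = "\<lambda>x y z. fa_mult x (fa_mult y z) + fa_mult y (fa_mult z x) + fa_mult z (fa_mult x y)"
  have J_add: "?J (f + g) y z = ?J f y z + ?J g y z" "?J x (f + g) z = ?J x f z + ?J x g z"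
    "?J x y (f + g) = ?J x y f + ?J x y g" for f g x y z :: "('g, 'k) free_alg"
    by (simp_all add: fa_mult_simps)
  show ?case
  proof (induction x rule: fa_induct)
    case (single u a)
    show ?case
    proof (induction y rule: fa_induct)
      case (single v b)
      show ?case
      proof (induction z rule: fa_induct)
        case (single w c)
        let ?c = "?J (Poly_Mapping.single u a) (Poly_Mapping.single v b) (Poly_Mapping.single w c)"
        have "\<forall>t\<in>Poly_Mapping.keys ?c. mdeg t = mdeg u + mdeg v + mdeg w"
          by (auto simp: fa_mult_single in_keys_iff lookup_add lookup_single when_def split: if_splits)
        from fa_part_cases[OF this] show ?case by (simp add: jj_ideal.jacobi jj_ideal_zero)
      next
        case (add f g)
        then show ?case unfolding J_add fa_part_add[of n "?J _ _ f"] by (rule jj_ideal.add)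
      qed
    next
      case (add f g)
      then show ?case unfolding J_add fa_part_add[of n "?J _ f _"] by (rule jj_ideal.add)
    qed
  next
    case (add f g)
    then show ?case unfolding J_add fa_part_add[of n "?J f _ _"] by (rule jj_ideal.add)
  qed
next
  case (mult_left x a)
  show ?case
    by (induction a rule: fa_induct)
      (auto simp: fa_part_mult_single_left fa_mult_simps fa_part_add
        intro: jj_ideal.intros mult_left jj_ideal_zero)
next
  case (mult_right x a)
  show ?case
    by (induction a rule: fa_induct)
      (auto simp: fa_part_mult_single_right fa_mult_simps fa_part_add
        intro: jj_ideal.intros mult_right jj_ideal_zero)
qed (simp_all add: fa_part_add fa_part_scale jj_ideal.intros)

lemma abs_free_jj_sum: "abs_free_jj (sum f S) = (\<Sum>i\<in>S. abs_free_jj (f i))"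
  by (induction S rule: infinite_finite_induct)
    (simp_all add: zero_free_jj_def flip: plus_free_jj.abs_eq)

lemma abs_free_jj_eq_0_iff: "abs_free_jj f = 0 \<longleftrightarrow> f \<in> jj_ideal"
  by (simp add: zero_free_jj_def free_jj.abs_eq_iff jj_rel_def)

theorem jj_component_independent:
  fixes c :: "nat \<Rightarrow> ('g, 'k::field) free_jj"
  assumes "finite S" "\<forall>n\<in>S. c n \<in> jj_component n" "(\<Sum>n\<in>S. c n) = 0" "n \<in> S"
  shows "c n = 0"
proof -
  have "\<forall>n\<in>S. \<exists>f. c n = abs_free_jj f \<and> (\<forall>u\<in>Poly_Mapping.keys f. mdeg u = n)"
    using assms(2) by (auto simp: jj_component_def)
  then obtain f where f: "\<forall>n\<in>S. c n = abs_free_jj (f n) \<and> (\<forall>u\<in>Poly_Mapping.keys (f n). mdeg u = n)"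
    by metis
  have "abs_free_jj (\<Sum>n\<in>S. f n) = 0"
    using assms(3) f by (simp add: abs_free_jj_sum)
  then have *: "fa_part n (\<Sum>n\<in>S. f n) \<in> jj_ideal"
    by (simp add: abs_free_jj_eq_0_iff fa_part_jj_ideal)
  have part_sum: "fa_part n (sum f T) = (\<Sum>i\<in>T. fa_part n (f i))" for T
    by (induction T rule: infinite_finite_induct)
      (auto simp: fa_part_add intro!: poly_mapping_eqI)
  have "fa_part n (\<Sum>n\<in>S. f n) = (\<Sum>i\<in>S. if i = n then f i else 0)"
    unfolding part_sum
  proof (rule sum.cong[OF refl])
    fix i assume "i \<in> S"
    with f have "\<forall>u\<in>Poly_Mapping.keys (f i). mdeg u = i" by blast
    from fa_part_cases[OF this, of n] show "fa_part n (f i) = (if i = n then f i else 0)" by auto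
  qed
  also have "\<dots> = f n" using assms by simp
  finally show ?thesis using * f assms by (simp add: abs_free_jj_eq_0_iff)
qed

theorem jj_component_spanning:
  fixes x :: "('g, 'k::field) free_jj"
  shows "\<exists>S c. finite S \<and> (\<forall>n\<in>S. c n \<in> jj_component n) \<and> x = (\<Sum>n\<in>S. c n)"
proof -
  obtain f where x: "x = abs_free_jj f"
    by (metis Quotient_free_jj Quotient_abs_rep)
  let ?S = "mdeg ` Poly_Mapping.keys f"
  have "f = (\<Sum>n\<in>?S. fa_part n f)"
    by (rule poly_mapping_eqI) (auto simp: lookup_sum sum.delta in_keys_iff)
  then have "x = (\<Sum>n\<in>?S. abs_free_jj (fa_part n f))"
    by (metis x abs_free_jj_sum)
  moreover have "abs_free_jj (fa_part n f) \<in> jj_component n" for n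
    unfolding jj_component_def by (rule imageI) (auto simp: in_keys_iff split: if_splits)
  ultimately show ?thesis
    by (intro exI[of _ ?S] exI[of _ "\<lambda>n. abs_free_jj (fa_part n f)"]) simp
qed

datatype gen2 = GX | GY

end

theory Submission
  imports Defs "HOL-Library.Function_Algebras"
begin

text \<open>
  Setting two arguments equal in the Jacobi identity gives \<open>x\<^sup>2 z = - 2 x (x z)\<close>.
  Computing one product both with this rule and with the Jacobi identity itself yields opposite signs in many places
  (for instance \<open>x (x\<^sup>2 y) = x\<^sup>2 (x y) = - x (x\<^sup>2 y)\<close>), which
  kills every product of degree at least five and leaves the eight listed elements as a spanning
  set. For their independence we read off the resulting multiplication table, check that
  it defines a Jacobi-Jordan algebra on coordinate vectors, and map the free algebra to it.
\<close>

section \<open>Algebras generated by two elements\<close>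

locale jacobi_jordan_algebra_char_0 = jacobi_jordan_algebra scale mult
  for scale :: "'k::field_char_0 \<Rightarrow> 'a::ab_group_add \<Rightarrow> 'a"
    and mult :: "'a \<Rightarrow> 'a \<Rightarrow> 'a" (infixl "\<cdot>" 70)
begin

section \<open>Consequences of the Jacobi identity in characteristic 0\<close>

lemma add_self: "x + x = scale 2 x" for x :: 'a
  using scale_left_distrib[of 1 1 x] by simp

lemma eq_uminus_self_imp_zero:
  fixes x :: 'a
  assumes "x = - x"
  shows "x = 0"
proof -
  have "scale 2 x = 0"
    using assms by (metis add_self add.right_inverse)
  then show ?thesis by simp
qed

lemma mult_minus_right: "x \<cdot> (- y) = - (x \<cdot> y)"
  using mult_scale_right[of x "- 1" y] by simp

lemma mult_cyclic: "x \<cdot> (y \<cdot> z) = - (y \<cdot> (x \<cdot> z)) - z \<cdot> (x \<cdot> y)"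
  using jacobi[of x y z] by (simp add: mult_commute[of z x] algebra_simps eq_neg_iff_add_eq_0)

lemma square_mult: "(x \<cdot> x) \<cdot> y = scale (- 2) (x \<cdot> (x \<cdot> y))"
proof -
  have "scale 2 (x \<cdot> (x \<cdot> y)) + (x \<cdot> x) \<cdot> y = 0"
    using jacobi[of x x y] by (simp add: mult_commute[of y x] mult_commute[of y "x \<cdot> x"] add_self)
  then show ?thesis by (simp add: add_eq_0_iff)
qed

lemma mult_mult_self: "x \<cdot> (x \<cdot> y) = scale (- 1 / 2) ((x \<cdot> x) \<cdot> y)"
  by (simp add: square_mult)

text \<open>The Jacobi identity at x, x, x reads 3 x^3 = 0, and 3 is invertible.\<close>

lemma cube: "x \<cdot> (x \<cdot> x) = 0"
proof -
  have "scale 3 (x \<cdot> (x \<cdot> x)) = x \<cdot> (x \<cdot> x) + x \<cdot> (x \<cdot> x) + x \<cdot> (x \<cdot> x)"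
    using scale_left_distrib[of 2 1 "x \<cdot> (x \<cdot> x)"] by (simp add: add_self)
  then show ?thesis using jacobi[of x x x] by simp
qed

lemma square_square: "(x \<cdot> x) \<cdot> (x \<cdot> x) = 0"
  by (simp add: square_mult cube mult_zero_right)

lemma mult_square_mult: "x \<cdot> ((x \<cdot> x) \<cdot> y) = 0"
  and square_mult_mult: "(x \<cdot> x) \<cdot> (x \<cdot> y) = 0"
proof -
  \<comment> \<open>By the square rule both sides equal -2 x(x(xy)). The Jacobi identity together
    with x^3 = 0 then gives the opposite sign.\<close>
  have 1: "(x \<cdot> x) \<cdot> (x \<cdot> y) = x \<cdot> ((x \<cdot> x) \<cdot> y)"
    by (simp add: square_mult mult_scale_right mult_minus_right)
  have "x \<cdot> ((x \<cdot> x) \<cdot> y) = - ((x \<cdot> x) \<cdot> (x \<cdot> y))"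
    using mult_cyclic[of x "x \<cdot> x" y] by (simp add: cube mult_zero_right)
  then show 2: "x \<cdot> ((x \<cdot> x) \<cdot> y) = 0"
    unfolding 1 by (rule eq_uminus_self_imp_zero)
  then show "(x \<cdot> x) \<cdot> (x \<cdot> y) = 0" by (simp add: 1)
qed

text \<open>This is the rule y(yz) = -(1/2) y^2 z at z = x^2.\<close>

lemma mult_square_mult_other: "y \<cdot> ((x \<cdot> x) \<cdot> y) = scale (- 1 / 2) ((x \<cdot> x) \<cdot> (y \<cdot> y))"
  using mult_mult_self[of y "x \<cdot> x"] by (simp add: mult_commute)

text \<open>The Jacobi identity for xy, x, y splits the square of xy into two terms, each worth
  -(1/4) x^2 y^2.\<close>

lemma mult_mult_same: "(x \<cdot> y) \<cdot> (x \<cdot> y) = scale (- 1 / 2) ((x \<cdot> x) \<cdot> (y \<cdot> y))"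
proof -
  have "(x \<cdot> y) \<cdot> (x \<cdot> y) = - (x \<cdot> (y \<cdot> (y \<cdot> x))) - y \<cdot> (x \<cdot> (x \<cdot> y))"
    using mult_cyclic[of "x \<cdot> y" x y] by (simp add: mult_commute)
  also have "\<dots> = scale (1 / 2) (x \<cdot> ((y \<cdot> y) \<cdot> x)) + scale (1 / 2) (y \<cdot> ((x \<cdot> x) \<cdot> y))"
    by (simp add: mult_mult_self mult_minus_right mult_scale_right)
  also have "\<dots> = scale (- 1 / 4 + - 1 / 4) ((x \<cdot> x) \<cdot> (y \<cdot> y))"
    unfolding scale_left_distrib mult_square_mult_other
    by (simp add: mult_commute[of "y \<cdot> y" "x \<cdot> x"])
  finally show ?thesis by simp
qed

text \<open>Multiplying by x^2 is -2 times multiplying twice by x, and x already kills x^2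
  y.\<close>

lemma square_square_mult: "(x \<cdot> x) \<cdot> ((x \<cdot> x) \<cdot> y) = 0"
  by (simp add: square_mult[of x "(x \<cdot> x) \<cdot> y"] mult_square_mult mult_zero_right)

text \<open>In the Jacobi identity for x^2 y, x, y, one term contains x(x^2 y) = 0. The other is a
  multiple of x(x^2 y^2), which vanishes by the same rule with y^2 for y.\<close>

lemma prod_square_mult: "(x \<cdot> y) \<cdot> ((x \<cdot> x) \<cdot> y) = 0"
proof -
  have "((x \<cdot> x) \<cdot> y) \<cdot> (x \<cdot> y) = 0"
    by (subst mult_cyclic) (simp add: mult_commute[of "(x \<cdot> x) \<cdot> y"] mult_square_mult
        mult_square_mult_other mult_scale_right mult_minus_right mult_zero_right)
  then show ?thesis by (simp add: mult_commute)
qed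

text \<open>Since z(xy) = -x(yz) - y(zx), the annihilator of z is closed under products. This
  carries vanishing in degree five over to higher degrees.\<close>

lemma mult_annihilates:
  assumes "x \<cdot> z = 0" "y \<cdot> z = 0"
  shows "(x \<cdot> y) \<cdot> z = 0"
  using jacobi[of x y z] assms by (simp add: mult_commute[of z] mult_zero_right)

section \<open>The graded multiplication table\<close>

definition layer :: "'a \<Rightarrow> 'a \<Rightarrow> nat \<Rightarrow> 'a set" where
  "layer x y n =
    (if n = 1 then {x, y}
     else if n = 2 then {x \<cdot> x, y \<cdot> y, x \<cdot> y}
     else if n = 3 then {(x \<cdot> x) \<cdot> y, x \<cdot> (y \<cdot> y)}
     else if n = 4 then {(x \<cdot> x) \<cdot> (y \<cdot> y)}
     else {})"

lemma layer_simps: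
  "layer x y 1 = {x, y}"
  "layer x y 2 = {x \<cdot> x, y \<cdot> y, x \<cdot> y}"
  "layer x y 3 = {(x \<cdot> x) \<cdot> y, x \<cdot> (y \<cdot> y)}"
  "layer x y 4 = {(x \<cdot> x) \<cdot> (y \<cdot> y)}"
  by (simp_all add: layer_def)

lemma layer_nonempty: "u \<in> layer x y n \<Longrightarrow> n = 1 \<or> n = 2 \<or> n = 3 \<or> n = 4"
  by (auto simp: layer_def split: if_splits)

text \<open>A finite table of products, halved by commutativity. Since \<open>layer\<close> is empty
  from degree five on, the claim there says that the product is zero.\<close>

lemma layer_mult:
  assumes "u \<in> layer x y m" "v \<in> layer x y n"
  shows "u \<cdot> v \<in> span (layer x y (m + n))"
  using assms
proof (induction m n arbitrary: u v rule: linorder_wlog)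
  case (sym m n)
  then show ?case by (metis add.commute mult_commute)
next
  case (le m n)
  \<comment> \<open>One letter per listed element: p, q, r in degree 2, a, b in degree 3, w in
    degree 4. The table becomes rewrite rules between letters.\<close>
  define p q r a b w where defs: "p = x \<cdot> x" "q = y \<cdot> y" "r = x \<cdot> y"
    "a = p \<cdot> y" "b = x \<cdot> q" "w = p \<cdot> q"
  have deg3: "x \<cdot> p = 0" "x \<cdot> q = b" "x \<cdot> r = scale (- 1 / 2) a"
    "y \<cdot> p = a" "y \<cdot> q = 0" "y \<cdot> r = scale (- 1 / 2) b"
    unfolding defs using cube mult_mult_self[of x y] mult_mult_self[of y x]
    by (simp_all add: mult_commute)
  have deg4: "x \<cdot> a = 0" "x \<cdot> b = scale (- 1 / 2) w" "y \<cdot> a = scale (- 1 / 2) w" "y \<cdot> b = 0"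
    "p \<cdot> p = 0" "p \<cdot> q = w" "p \<cdot> r = 0" "q \<cdot> q = 0" "q \<cdot> p = w" "q \<cdot> r = 0"
    "r \<cdot> p = 0" "r \<cdot> q = 0" "r \<cdot> r = scale (- 1 / 2) w"
    unfolding defs
    using mult_square_mult[of x y] mult_square_mult[of y x] mult_square_mult_other[of y x]
      mult_square_mult_other[of x y] square_square square_mult_mult[of x y]
      square_mult_mult[of y x] mult_mult_same[of x y]
    by (simp_all add: mult_commute)
  \<comment> \<open>Several entries are degree four identities with a square substituted: x w is
    x(x^2 z) and p b is x^2 (x z), both at z = y^2.\<close>
  have deg5: "x \<cdot> w = 0" "y \<cdot> w = 0" "p \<cdot> a = 0" "p \<cdot> b = 0" "q \<cdot> a = 0" "q \<cdot> b = 0"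
    "r \<cdot> a = 0" "r \<cdot> b = 0"
    unfolding defs
    using mult_square_mult[of x "y \<cdot> y"] mult_square_mult[of y "x \<cdot> x"]
      square_square_mult[of x y] square_square_mult[of y x]
      square_mult_mult[of x "y \<cdot> y"] square_mult_mult[of y "x \<cdot> x"]
      prod_square_mult[of x y] prod_square_mult[of y x]
    by (simp_all add: mult_commute)
  have deg6: "p \<cdot> w = 0" "q \<cdot> w = 0" "r \<cdot> w = 0"
    using deg5 by (simp_all add: defs(1-3) mult_annihilates)
  \<comment> \<open>Both are multiples of products with w. In the Jacobi identity for p, y, a only
    (p y) a = a a then survives; likewise for q, x, b.\<close>
  have "p \<cdot> (y \<cdot> a) = 0" "q \<cdot> (x \<cdot> b) = 0"
    using deg4 deg6 by (simp_all add: mult_scale_right mult_minus_right)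
  then have deg6': "a \<cdot> a = 0" "b \<cdot> b = 0"
    using jacobi[of p y a] jacobi[of q x b] deg5
    by (simp_all add: defs(4,5) mult_commute[of _ p] mult_commute[of _ q] mult_zero_right)
  \<comment> \<open>Both factors of b = x q annihilate a.\<close>
  have deg6'': "b \<cdot> a = 0" "a \<cdot> b = 0"
    using mult_annihilates[of x a q] deg4 deg5 by (simp_all add: defs(5) mult_commute)
  have deg7: "a \<cdot> w = 0" "b \<cdot> w = 0"
    using deg5 deg6 by (simp_all add: defs(4,5) mult_annihilates)
  have deg8: "w \<cdot> w = 0"
    using mult_annihilates[of p w q] deg6 by (simp add: defs(6))
  have layers: "layer x y 1 = {x, y}" "layer x y 2 = {p, q, r}"
    "layer x y 3 = {a, b}" "layer x y 4 = {w}"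
    by (simp_all only: layer_simps defs)
  have deg2: "x \<cdot> x = p" "x \<cdot> y = r" "y \<cdot> x = r" "y \<cdot> y = q"
    by (simp_all add: defs mult_commute)
  \<comment> \<open>Negated forms are listed because \<open>scale (- c) a\<close> simplifies to
    \<open>- scale c a\<close>.\<close>
  have span: "p \<in> span {p, q, r}" "q \<in> span {p, q, r}" "r \<in> span {p, q, r}"
    "scale c a \<in> span {a, b}" "scale c b \<in> span {a, b}" "scale c w \<in> span {w}"
    "- scale c a \<in> span {a, b}" "- scale c b \<in> span {a, b}" "- scale c w \<in> span {w}"
    "a \<in> span {a, b}" "b \<in> span {a, b}" "w \<in> span {w}" for c
    by (auto intro: span_base span_scale span_neg)
  from le(1) layer_nonempty[OF le(2)] layer_nonempty[OF le(3)] consider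
    "m = 1" "n = 1" | "m = 1" "n = 2" | "m = 1" "n = 3" | "m = 1" "n = 4"
    | "m = 2" "n = 2" | "m = 2" "n = 3" | "m = 2" "n = 4" | "m = 3" "n = 3" | "m = 3" "n = 4"
    | "m = 4" "n = 4"
    by auto
  then show ?case
    by cases (use le(2,3) in \<open>auto simp: layers deg2 deg3 deg4 deg5 deg6 deg6' deg6'' deg7 deg8
        span_zero simp del: One_nat_def intro: span\<close>)
qed

lemma mult_in_subspace:
  assumes "u \<in> span A" "v \<in> span B" "subspace S" "\<And>a b. a \<in> A \<Longrightarrow> b \<in> B \<Longrightarrow> a \<cdot> b \<in> S"
  shows "u \<cdot> v \<in> S"
  using assms(1)
proof (induction rule: span_induct_alt)
  case base
  show ?case using assms(3) by (simp add: mult_zero_left subspace_0)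
next
  case (step c a u)
  have "a \<cdot> v \<in> S"
    using assms(2)
    by (induction rule: span_induct_alt)
      (use assms(3,4) step(1) in \<open>auto simp: mult_zero_right mult_add_right mult_scale_right
         intro: subspace_0 subspace_add subspace_scale\<close>)
  then show ?case
    using step(2) assms(3) by (simp add: mult_add_left mult_scale_left subspace_add subspace_scale)
qed

lemma span_layer_mult:
  assumes "u \<in> span (layer x y m)" "v \<in> span (layer x y n)"
  shows "u \<cdot> v \<in> span (layer x y (m + n))"
  by (rule mult_in_subspace[OF assms subspace_span layer_mult])

end

text \<open>The i-th functional kills the span of the other vectors but not the i-th one. Diagonal
  values need only be nonzero, which allows for rescaled coordinates.\<close>

lemma (in vector_space) independent_if_dual:
  assumes linear: "\<And>i. i < length us \<Longrightarrow> Vector_Spaces.linear scale (*) (\<phi> i)"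
    and dual: "\<And>i j. i < length us \<Longrightarrow> j < length us \<Longrightarrow> \<phi> i (us ! j) = 0 \<longleftrightarrow> i \<noteq> j"
  shows "distinct us" "independent (set us)"
proof -
  show "distinct us"
    unfolding distinct_conv_nth using dual by metis
  show "independent (set us)"
  proof
    assume "dependent (set us)"
    then obtain i where i: "i < length us" "us ! i \<in> span (set us - {us ! i})"
      by (auto simp: dependent_def in_set_conv_nth)
    interpret \<phi>: Vector_Spaces.linear scale "(*)" "\<phi> i"
      using linear i(1) .
    have "\<phi> i (us ! i) = 0"
      using i by (intro \<phi>.eq_0_on_span[OF _ i(2)]) (auto simp: in_set_conv_nth dual)
    then show False using dual i(1) by blast
  qed
qed

section \<open>The coordinate model\<close>

text \<open>Coordinates \<open>0, \<dots>, 7\<close> refer to the basis \<open>X\<close>, \<open>Y\<close>, \<open>X\<^sup>2\<close>, \<open>Y\<^sup>2\<close>, \<open>XY\<close>,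
  \<open>X(XY)\<close>, \<open>Y(XY)\<close>, \<open>X\<^sup>2Y\<^sup>2/4\<close>,
  which is scaled so that all structure constants are integers.\<close>

definition model_scale :: "'k::field \<Rightarrow> (nat \<Rightarrow> 'k) \<Rightarrow> nat \<Rightarrow> 'k" where
  "model_scale c f = (\<lambda>i. c * f i)"

text \<open>The table above in these coordinates. For example X^2 Y = -2 X(XY) gives the factor -2
  at index 5, and (XY)^2 = -(1/2) X^2 Y^2 gives the -2 at index 7.\<close>

definition model_mult :: "(nat \<Rightarrow> 'k::field) \<Rightarrow> (nat \<Rightarrow> 'k) \<Rightarrow> nat \<Rightarrow> 'k" where
  "model_mult f g = (\<lambda>i.
     if i = 2 then f 0 * g 0
     else if i = 3 then f 1 * g 1
     else if i = 4 then f 0 * g 1 + f 1 * g 0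
     else if i = 5 then f 0 * g 4 + f 4 * g 0 - 2 * (f 1 * g 2 + f 2 * g 1)
     else if i = 6 then f 1 * g 4 + f 4 * g 1 - 2 * (f 0 * g 3 + f 3 * g 0)
     else if i = 7 then f 0 * g 6 + f 6 * g 0 + f 1 * g 5 + f 5 * g 1
       + 4 * (f 2 * g 3 + f 3 * g 2) - 2 * (f 4 * g 4)
     else 0)"

lemma jacobi_jordan_algebra_model:
  "jacobi_jordan_algebra model_scale (model_mult :: (nat \<Rightarrow> 'k::field) \<Rightarrow> _)"
proof
  fix x y z :: "nat \<Rightarrow> 'k" and a b :: 'k
  show "model_scale a (x + y) = model_scale a x + model_scale a y"
    by (simp add: model_scale_def fun_eq_iff algebra_simps)
  show "model_scale (a + b) x = model_scale a x + model_scale b x"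
    by (simp add: model_scale_def fun_eq_iff algebra_simps)
  show "model_scale a (model_scale b x) = model_scale (a * b) x"
    by (simp add: model_scale_def fun_eq_iff)
  show "model_scale 1 x = x"
    by (simp add: model_scale_def)
  show "model_mult x y = model_mult y x"
    by (simp add: model_mult_def fun_eq_iff algebra_simps)
  show "model_mult (x + y) z = model_mult x z + model_mult y z"
    by (simp add: model_mult_def fun_eq_iff algebra_simps)
  show "model_mult (model_scale a x) y = model_scale a (model_mult x y)"
    by (simp add: model_mult_def model_scale_def fun_eq_iff algebra_simps)
  \<comment> \<open>Products have zero coordinates at 0 and 1, so a double product lives at 5, 6, 7
    only. There the identity is polynomial in the coordinates.\<close>
  show "model_mult x (model_mult y z) + model_mult y (model_mult z x)
      + model_mult z (model_mult x y) = 0"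
    by (simp add: model_mult_def fun_eq_iff algebra_simps)
qed

section \<open>The free algebra on two generators\<close>

global_interpretation free_jj0: jacobi_jordan_algebra_char_0
  "jj_scale :: 'k::field_char_0 \<Rightarrow> ('g, 'k) free_jj \<Rightarrow> ('g, 'k) free_jj" "(*)"
  by unfold_locales

section \<open>Homogeneous components as spans of layers\<close>

lemma subspace_jj_component:
  "free_jj.subspace (jj_component n :: ('g, 'k::field) free_jj set)"
proof (rule free_jj.subspaceI)
  show "(0 :: ('g, 'k) free_jj) \<in> jj_component n"
    by (auto simp: jj_component_def zero_free_jj_def)
next
  fix x y :: "('g, 'k) free_jj"
  assume "x \<in> jj_component n" "y \<in> jj_component n"
  then obtain f g where fg: "x = abs_free_jj f" "y = abs_free_jj g"
    "\<forall>u\<in>Poly_Mapping.keys f. mdeg u = n" "\<forall>u\<in>Poly_Mapping.keys g. mdeg u = n"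
    by (auto simp: jj_component_def)
  then have "\<forall>u\<in>Poly_Mapping.keys (f + g). mdeg u = n"
    using keys_add[of f g] by blast
  then show "x + y \<in> jj_component n"
    using fg by (auto simp: jj_component_def plus_free_jj.abs_eq)
next
  fix c and x :: "('g, 'k) free_jj"
  assume "x \<in> jj_component n"
  then obtain f where f: "x = abs_free_jj f" "\<forall>u\<in>Poly_Mapping.keys f. mdeg u = n"
    by (auto simp: jj_component_def)
  then have "\<forall>u\<in>Poly_Mapping.keys (fa_scale c f). mdeg u = n"
    by (auto simp: in_keys_iff)
  then show "jj_scale c x \<in> jj_component n"
    using f by (auto simp: jj_component_def jj_scale.abs_eq)
qed

lemma jj_gen_component: "jj_gen g \<in> jj_component 1"
  by (auto simp: jj_component_def jj_gen.abs_eq)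

lemma fa_single_eq_scale: "Poly_Mapping.single u c = fa_scale c (Poly_Mapping.single u 1)"
  by (rule poly_mapping_eqI) (simp add: lookup_single when_def)

text \<open>Induction on monomials with \<open>span_layer_mult\<close> puts each monomial into the
  span for its degree. Conversely, every layer element is a product of generators of the right
  degree.\<close>

lemma jj_component_eq_span_layer:
  "jj_component n =
    free_jj.span (free_jj0.layer (jj_gen GX :: (gen2, 'k::field_char_0) free_jj) (jj_gen GY) n)"
    (is "_ = free_jj.span (?L n)")
proof
  have mono: "abs_free_jj (Poly_Mapping.single u 1) \<in> free_jj.span (?L (mdeg u))" for u
  proof (induction u)
    case (Gen g)
    show ?case
      by (cases g) (auto simp: free_jj0.layer_def jj_gen.abs_eq intro: free_jj.span_base)
  next
    case (MProd u v)
    from free_jj0.span_layer_mult[OF this] show ?case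
      by (simp add: times_free_jj.abs_eq fa_mult_single)
  qed
  show "jj_component n \<subseteq> free_jj.span (?L n)"
  proof
    fix x :: "(gen2, 'k) free_jj"
    assume "x \<in> jj_component n"
    then obtain f where f: "x = abs_free_jj f" "\<forall>u\<in>Poly_Mapping.keys f. mdeg u = n"
      by (auto simp: jj_component_def)
    have "f = (\<Sum>u\<in>Poly_Mapping.keys f. Poly_Mapping.single u (Poly_Mapping.lookup f u))"
      by (rule poly_mapping_eqI)
        (simp add: lookup_sum lookup_single when_def sum.delta' in_keys_iff)
    then have "x = (\<Sum>u\<in>Poly_Mapping.keys f. jj_scale (Poly_Mapping.lookup f u)
        (abs_free_jj (Poly_Mapping.single u 1)))"
      by (metis (no_types, lifting) f(1) abs_free_jj_sum fa_single_eq_scale jj_scale.abs_eq sum.cong)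
    then show "x \<in> free_jj.span (?L n)"
      using f(2) mono by (auto intro!: free_jj.span_sum free_jj.span_scale)
  qed
  have XY: "jj_gen GX \<in> jj_component 1" "jj_gen GY \<in> jj_component 1"
    by (rule jj_gen_component)+
  have "?L n \<subseteq> jj_component n"
    using XY jj_component_mult[OF XY(1,1)] jj_component_mult[OF XY(1,2)]
      jj_component_mult[OF XY(2,2)]
      jj_component_mult[OF jj_component_mult[OF XY(1,1)] XY(2)]
      jj_component_mult[OF XY(1) jj_component_mult[OF XY(2,2)]]
      jj_component_mult[OF jj_component_mult[OF XY(1,1)] jj_component_mult[OF XY(2,2)]]
    by (auto simp: free_jj0.layer_def numeral_eq_Suc)
  then show "free_jj.span (?L n) \<subseteq> jj_component n"
    by (rule free_jj.span_minimal[OF _ subspace_jj_component])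
qed

theorem proposition38:
  fixes X Y :: "(gen2, 'k::field_char_0) free_jj"
  assumes X: "X = jj_gen GX" and Y: "Y = jj_gen GY"
  shows "(\<exists>B. finite_dimensional_vector_space
                (jj_scale :: 'k \<Rightarrow> (gen2, 'k) free_jj \<Rightarrow> (gen2, 'k) free_jj) B) \<and>
         internal_direct_sum {1..4} jj_component (UNIV :: (gen2, 'k) free_jj set) \<and>
         free_jj.is_basis [X, Y] (jj_component 1) \<and>
         free_jj.is_basis [X * X, Y * Y, X * Y] (jj_component 2) \<and>
         free_jj.is_basis [(X * X) * Y, X * (Y * Y)] (jj_component 3) \<and>
         free_jj.is_basis [(X * X) * (Y * Y)] (jj_component 4)"
proof -
  let ?L = "free_jj0.layer X Y"
  have comp: "jj_component n = free_jj.span (?L n)" for n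
    unfolding X Y by (rule jj_component_eq_span_layer)
  \<comment> \<open>The layers outside degrees 1 to 4 are empty, and the span of the empty set is
    zero.\<close>
  have outside: "x = 0" if "x \<in> jj_component n" "n \<notin> {1..4}" for n and x :: "(gen2, 'k) free_jj"
    using that unfolding comp by (auto simp: free_jj0.layer_def split: if_splits)
  have sum_ex: "\<exists>c. (\<forall>i\<in>{1..4}. c i \<in> jj_component i) \<and> x = (\<Sum>i\<in>{1..4}. c i)"
    for x :: "(gen2, 'k) free_jj"
  proof -
    obtain S c where S: "finite S" "\<forall>n\<in>S. c n \<in> jj_component n" "x = (\<Sum>n\<in>S. c n)"
      using jj_component_spanning by blast
    \<comment> \<open>Degrees in 1 to 4 that are missing from S get the summand 0.\<close>
    let ?c = "\<lambda>n. if n \<in> S then c n else 0"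
    have "x = (\<Sum>n\<in>S \<inter> {1..4}. c n)"
      unfolding S(3) using S(1,2) by (intro sum.mono_neutral_right) (auto intro: outside)
    also have "\<dots> = (\<Sum>n\<in>{1..4}. ?c n)"
      using sum.inter_restrict[of "{1..4}" c S] by (simp add: Int_commute)
    finally have "x = (\<Sum>n\<in>{1..4}. ?c n)" .
    moreover have "(0 :: (gen2, 'k) free_jj) \<in> jj_component n" for n
      by (rule free_jj.subspace_0[OF subspace_jj_component])
    ultimately show ?thesis
      using S(2) by (intro exI[of _ ?c]) simp
  qed
  have direct: "internal_direct_sum {1..4} jj_component (UNIV :: (gen2, 'k) free_jj set)"
    unfolding internal_direct_sum_def
  proof (intro conjI allI impI ballI)
    show "UNIV = {\<Sum>i\<in>{1..4}. c i |c. \<forall>i\<in>{1..4}. c i \<in> (jj_component i :: (gen2, 'k) free_jj set)}"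
      using sum_ex by blast
  next
    fix c :: "nat \<Rightarrow> (gen2, 'k) free_jj" and i :: nat
    assume "(\<forall>i\<in>{1..4}. c i \<in> jj_component i) \<and> sum c {1..4} = 0" "i \<in> {1..4}"
    then show "c i = 0" using jj_component_independent[of "{1..4}" c i] by blast
  qed
  let ?T = "\<Union>n\<in>{1..4}. ?L n"
  have "x \<in> free_jj.span ?T" for x
  proof -
    obtain c where c: "\<forall>i\<in>{1..4}. c i \<in> jj_component i" "x = (\<Sum>i\<in>{1..4}. c i)"
      using sum_ex by blast
    have "c i \<in> free_jj.span ?T" if "i \<in> {1..4}" for i
      using c(1) that free_jj.span_mono[of "?L i" ?T] unfolding comp by blast
    then show ?thesis unfolding c(2) by (rule free_jj.span_sum)
  qed
  then have span_T: "free_jj.span ?T = UNIV" by blast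
  \<comment> \<open>A basis is extracted from the finite spanning set \<open>?T\<close>.\<close>
  have "finite ?T" by (auto simp: free_jj0.layer_def)
  moreover obtain B where B: "B \<subseteq> ?T" "free_jj.independent B" "?T \<subseteq> free_jj.span B"
    using free_jj.maximal_independent_subset[of ?T] by blast
  moreover have "free_jj.span B = UNIV"
    using free_jj.span_minimal[OF B(3) free_jj.subspace_span] span_T by blast
  ultimately have "finite_dimensional_vector_space
      (jj_scale :: 'k \<Rightarrow> (gen2, 'k) free_jj \<Rightarrow> (gen2, 'k) free_jj) B"
    by unfold_locales (auto intro: finite_subset)
  then have findim: "\<exists>B. finite_dimensional_vector_space
      (jj_scale :: 'k \<Rightarrow> (gen2, 'k) free_jj \<Rightarrow> (gen2, 'k) free_jj) B" ..

  \<comment> \<open>The universal property sends X and Y to the unit vectors 0 and 1 of the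
    model.\<close>
  obtain h :: "(gen2, 'k) free_jj \<Rightarrow> nat \<Rightarrow> 'k" where
    h: "Vector_Spaces.linear jj_scale model_scale h" "\<And>x y. h (x * y) = model_mult (h x) (h y)"
      "\<And>g. h (jj_gen g) = (\<lambda>i. of_bool (i = (case g of GX \<Rightarrow> 0 | GY \<Rightarrow> 1)))"
    using free_jj_universal[OF jacobi_jordan_algebra_model,
        of "\<lambda>g i. of_bool (i = (case g of GX \<Rightarrow> 0 | GY \<Rightarrow> 1))"] by blast
  interpret h: Vector_Spaces.linear jj_scale model_scale h by (rule h(1))
  have coord: "Vector_Spaces.linear jj_scale (*) (\<lambda>x. h x i)" for i
    by unfold_locales (simp_all add: h.add h.scale model_scale_def algebra_simps)
  \<comment> \<open>The offset k is where the coordinates of a degree start: 0, 2, 5, 7 for degrees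
    1 to 4. The images of the listed elements are unit vectors in degrees 1 and 2, and unit vectors
    times -2 and 4 in degrees 3 and 4; these factors are nonzero in characteristic 0.\<close>
  have basis: "free_jj.is_basis us (jj_component n)"
    if "set us = ?L n" "\<And>i j. i < length us \<Longrightarrow> j < length us \<Longrightarrow> h (us ! j) (k + i) = 0 \<longleftrightarrow> i \<noteq> j"
    for us n k
    using free_jj.independent_if_dual[of us "\<lambda>i x. h x (k + i)", OF coord that(2)] that(1)
    by (simp add: free_jj.is_basis_def comp)
  have "free_jj.is_basis [X, Y] (jj_component 1)"
    by (rule basis[of _ _ 0]) (auto simp: free_jj0.layer_def X Y h(3) less_Suc_eq)
  moreover have "free_jj.is_basis [X * X, Y * Y, X * Y] (jj_component 2)"
    by (rule basis[of _ _ 2])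
      (auto simp: free_jj0.layer_def X Y h(2,3) model_mult_def less_Suc_eq)
  moreover have "free_jj.is_basis [(X * X) * Y, X * (Y * Y)] (jj_component 3)"
    by (rule basis[of _ _ 5])
      (auto simp: free_jj0.layer_def X Y h(2,3) model_mult_def less_Suc_eq)
  moreover have "free_jj.is_basis [(X * X) * (Y * Y)] (jj_component 4)"
    by (rule basis[of _ _ 7]) (auto simp: free_jj0.layer_def X Y h(2,3) model_mult_def)
  ultimately show ?thesis using findim direct by blast
qed

end
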